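(* Let $b\geq 2$, $e\geq 1$, $h\geq 1$, $u\geq 1$ be integers. Let $\delta$ be a positive integer, and let $$d=\frac{g(e)+1}{1-\left(\frac{b-2}{b-1}\right)^{e}}+\delta.$$ If $\sigma_{h,e,b}(u)$ has at least $d$ base $b$ digits, then the base $b$ expansion of $\sigma_{h,e,b}(u)$ is of the form $$\sigma_{h,e,b}(u)=\sum_{i=0}^{n-1}a_{i}b^{i}$$ with $a_{0}=a_1=\dots=a_{\delta}=b-1$; that is, the rightmost $\delta+1$ base $b$ digits of $\sigma_{h,e,b}(u)$ are all equal to $b-1$.
   Context: For integers $b\ge 2$ and $e\ge 1$, $S_{e,b}$ is the function on positive integers sending $x=\sum_{i=0}^{n-1}a_i b^i$ (with digits $0\le a_i\le b-1$) to $S_{e,b}(x)=\sum_{i=0}^{n-1}a_i^e$. $S_{e,b}^{h}$ denotes the $h$-fold iterate, with $S_{e,b}^0(x)=x$. For a positive integer $u$ (the attractor), a positive integer $x$ is a height $h$, $u$ attracted number if $h$ is the smallest nonnegative integer with $S_{e,b}^h(x)=u$. $\sigma_{h,e,b}(u)$ denotes the smallest height $h$, $u$ attracted number, i.e. the smallest positive integer $k$ with $S_{e,b}^h(k)=u$ and $S_{e,b}^m(k)\neq u$ for all $0\le m<h$. $g(e)$ denotes the smallest integer such that every nonnegative integer can be written as $x_1^e+x_2^e+\dots+x_{g(e)}^e$ with $x_1,\dots,x_{g(e)}$ nonnegative integers (Waring's problem). In the expansion, $n$ is the number of base $b$ digits and $0\le a_i\le b-1$. *)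

theory Defs
  imports Complex_Main "HOL-Library.Log_Nat" "HOL-Library.Extended_Real"
begin

definition digit :: "nat \<Rightarrow> nat \<Rightarrow> nat \<Rightarrow> nat" where
  "digit b x i = x div b ^ i mod b"

text \<open>For \<open>b \<ge> 2\<close> and \<open>x > 0\<close>, \<^const>\<open>floorlog\<close> is the number of base \<open>b\<close> digits of \<open>x\<close>.\<close>

definition digit_power_sum :: "nat \<Rightarrow> nat \<Rightarrow> nat \<Rightarrow> nat" where
  "digit_power_sum e b x = (\<Sum>i<floorlog b x. digit b x i ^ e)"

definition attracted :: "nat \<Rightarrow> nat \<Rightarrow> nat \<Rightarrow> nat \<Rightarrow> nat \<Rightarrow> bool" where
  "attracted h e b u x \<longleftrightarrow>
     x > 0 \<and> (digit_power_sum e b ^^ h) x = u \<and> (\<forall>m<h. (digit_power_sum e b ^^ m) x \<noteq> u)"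

definition sigma :: "nat \<Rightarrow> nat \<Rightarrow> nat \<Rightarrow> nat \<Rightarrow> nat" where
  "sigma h e b u = (LEAST k. attracted h e b u k)"

definition all_sums_of_powers :: "nat \<Rightarrow> nat \<Rightarrow> bool" where
  "all_sums_of_powers e s \<longleftrightarrow>
     (\<forall>m::nat. \<exists>x::nat \<Rightarrow> nat. m = (\<Sum>i<s. x i ^ e))"

text \<open>
  Waring's \<open>g(e)\<close>, the least \<open>s\<close> such that all natural numbers are sums of \<open>s\<close> \<open>e\<close>-th powers.
  It is finite for every \<open>e \<ge> 1\<close> by the Hilbert--Waring theorem. Since that theorem is not
  needed to define the number, the infimum is taken in \<^typ>\<open>enat\<close>, so that it is meaningful
  without a prior existence proof.
\<close>

definition waring_g :: "nat \<Rightarrow> enat" where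
  "waring_g e = Inf (enat ` {s. all_sums_of_powers e s})"

lemma waring_g_eq_iff:
  "waring_g e = enat s \<longleftrightarrow>
     all_sums_of_powers e s \<and> (\<forall>t. all_sums_of_powers e t \<longrightarrow> s \<le> t)"
proof
  assume eq: "waring_g e = enat s"
  have ne: "enat ` {s. all_sums_of_powers e s} \<noteq> {}"
  proof
    assume "enat ` {s. all_sums_of_powers e s} = {}"
    then have "waring_g e = \<infinity>"
      unfolding waring_g_def by (simp only: Inf_empty top_enat_def)
    with eq show False by simp
  qed
  then have "waring_g e \<in> enat ` {s. all_sums_of_powers e s}"
    unfolding waring_g_def by (meson wellorder_InfI all_not_in_conv)
  moreover have "s \<le> t" if "all_sums_of_powers e t" for t
  proof -
    have "waring_g e \<le> enat t"
      unfolding waring_g_def using that by (intro Inf_lower) auto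
    with eq show ?thesis by simp
  qed
  ultimately show "all_sums_of_powers e s \<and> (\<forall>t. all_sums_of_powers e t \<longrightarrow> s \<le> t)"
    using eq by auto
next
  assume "all_sums_of_powers e s \<and> (\<forall>t. all_sums_of_powers e t \<longrightarrow> s \<le> t)"
  then show "waring_g e = enat s"
    unfolding waring_g_def by (intro antisym Inf_lower Inf_greatest) auto
qed

end

theory Submission
  imports Defs
begin

text \<open>
  Let \<open>x = sigma h e b u\<close> and \<open>y\<close> its digit power sum. A preimage of \<open>y\<close> other than \<open>u\<close> has
  height \<open>h\<close>, so \<open>x\<close> is the least of these. The exception matters only if \<open>u\<close> itself maps to
  \<open>y\<close>; then \<open>u\<close> lies on a cycle and, since \<open>b * u\<close> also maps to \<open>y\<close>, has at least \<open>n - 1\<close> digits.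
  No number with so many digits is periodic, so \<open>x\<close> is the least preimage of \<open>y\<close>.

  Suppose the digit at a position \<open>j \<le> \<delta>\<close> is not \<open>b - 1\<close>. A digit \<open>b - 1\<close> at a higher
  position could be exchanged with it, making \<open>x\<close> smaller; hence all digits from position \<open>j\<close>
  upwards are at most \<open>b - 2\<close>. The sum of their powers can then be rewritten with as many copies of
  \<open>(b - 1) ^ e\<close> as possible and a remainder that is a sum of \<open>g(e)\<close> powers. The bound on \<open>n\<close>
  says that this takes fewer digits than before, contradicting minimality.
\<close>

lemma sum_lessThan_add:
  fixes F :: "nat \<Rightarrow> 'a::comm_monoid_add"
  shows "(\<Sum>i<a + k. F i) = (\<Sum>i<a. F i) + (\<Sum>i<k. F (a + i))"
  by (induction k) (simp_all add: add.assoc)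

section \<open>Positional notation and digit power sums\<close>

lemma floorlog_bounds_nat:
  fixes b x :: nat
  assumes "b \<ge> 2" and "x > 0"
  shows "b ^ (floorlog b x - 1) \<le> x" and "x < b ^ floorlog b x"
  using floorlog_bounds[of x b] assms by auto

lemma digit_Suc: "digit b x (Suc i) = digit b (x div b) i"
  by (simp add: digit_def div_mult2_eq)

lemma digit_less: "b > 0 \<Longrightarrow> digit b x i < b"
  by (simp add: digit_def)

lemma sum_digits_eq:
  assumes "x < b ^ n"
  shows "(\<Sum>i<n. digit b x i * b ^ i) = x"
  using assms
proof (induction n arbitrary: x)
  case (Suc n)
  have "x div b < b ^ n"
    using Suc.prems by (simp add: less_mult_imp_div_less mult.commute)
  then have IH: "(\<Sum>i<n. digit b (x div b) i * b ^ i) = x div b"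
    by (rule Suc.IH)
  have "(\<Sum>i<Suc n. digit b x i * b ^ i)
      = digit b x 0 + (\<Sum>i<n. b * (digit b (x div b) i * b ^ i))"
    by (subst sum.lessThan_Suc_shift) (simp add: digit_Suc ac_simps)
  also have "\<dots> = x mod b + b * (x div b)"
    by (simp only: sum_distrib_left[symmetric] IH) (simp add: digit_def)
  finally show ?case by simp
qed simp

lemma positional_less:
  fixes f :: "nat \<Rightarrow> nat"
  assumes "\<And>i. i < n \<Longrightarrow> f i < b"
  shows "(\<Sum>i<n. f i * b ^ i) < b ^ n"
  using assms
proof (induction n)
  case (Suc n)
  have "(\<Sum>i<n. f i * b ^ i) < b ^ n"
    using Suc by simp
  moreover have "(f n + 1) * b ^ n \<le> b * b ^ n"
    using Suc.prems[of n] by (intro mult_right_mono) auto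
  ultimately show ?case by simp
qed simp

text \<open>Leading zeros contribute \<open>0 ^ e = 0\<close> because \<open>e \<ge> 1\<close>, so
  any sufficient \<open>n\<close> may replace the exact digit count.\<close>

lemma digit_power_sum_eq_sum:
  assumes "b \<ge> 2" and "e \<ge> 1" and "x < b ^ n"
  shows "digit_power_sum e b x = (\<Sum>i<n. digit b x i ^ e)"
proof (cases "x = 0")
  case True
  then show ?thesis
    using assms by (simp add: digit_power_sum_def digit_def)
next
  case False
  have le: "floorlog b x \<le> n"
  proof (rule ccontr)
    assume "\<not> ?thesis"
    then have "b ^ n \<le> b ^ (floorlog b x - 1)"
      using assms(1) by (intro power_increasing) auto
    also have "\<dots> \<le> x"
      using floorlog_bounds_nat(1) False assms(1) by simp
    finally show False
      using assms(3) by simp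
  qed
  have "digit b x i ^ e = 0" if "i \<ge> floorlog b x" for i
  proof -
    have "x < b ^ floorlog b x"
      using floorlog_bounds_nat(2) False assms(1) by simp
    also have "\<dots> \<le> b ^ i"
      using that assms(1) by (intro power_increasing) auto
    finally show ?thesis
      using assms(2) by (simp add: digit_def)
  qed
  then show ?thesis
    unfolding digit_power_sum_def using le
    by (intro sum.mono_neutral_left) auto
qed

lemma digit_power_sum_rec:
  assumes "b \<ge> 2" and "e \<ge> 1"
  shows "digit_power_sum e b x = (x mod b) ^ e + digit_power_sum e b (x div b)"
proof -
  \<comment> \<open>A crude digit count, \<open>Suc x\<close> for \<open>x\<close> and
    \<open>x\<close> for \<open>x div b\<close>, avoids computing \<open>floorlog\<close> of the
    quotient.\<close>
  have "x < b ^ x"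
    using assms by (simp add: power_gt_expt)
  also have "b ^ x \<le> b ^ Suc x"
    using assms by (intro power_increasing) auto
  finally have x: "x < b ^ Suc x" .
  then have "x div b < b ^ x"
    by (simp add: less_mult_imp_div_less mult.commute)
  then have "digit_power_sum e b (x div b) = (\<Sum>i<x. digit b x (Suc i) ^ e)"
    using digit_power_sum_eq_sum[OF assms] by (simp add: digit_Suc)
  moreover have "digit_power_sum e b x = digit b x 0 ^ e + (\<Sum>i<x. digit b x (Suc i) ^ e)"
    using digit_power_sum_eq_sum[OF assms x] by (simp add: sum.lessThan_Suc_shift del: sum.lessThan_Suc)
  ultimately show ?thesis
    by (simp add: digit_def)
qed

lemma digit_power_sum_0 [simp]: "digit_power_sum e b 0 = 0"
  by (simp add: digit_power_sum_def floorlog_def)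

lemma digit_power_sum_mult_base:
  assumes "b \<ge> 2" and "e \<ge> 1"
  shows "digit_power_sum e b (b * x) = digit_power_sum e b x"
  using digit_power_sum_rec[OF assms, of "b * x"] assms by simp

text \<open>Turns prescribed digits into a number with known digit power sum. The top digits may be
  zero, so constructed digit sequences need no normalisation.\<close>

lemma digit_power_sum_positional:
  fixes f :: "nat \<Rightarrow> nat"
  assumes "b \<ge> 2" and "e \<ge> 1" and "\<And>i. i < n \<Longrightarrow> f i < b"
  shows "digit_power_sum e b (\<Sum>i<n. f i * b ^ i) = (\<Sum>i<n. f i ^ e)"
  using assms(3)
proof (induction n arbitrary: f)
  case (Suc n)
  have "(\<Sum>i<Suc n. f i * b ^ i) = f 0 + b * (\<Sum>i<n. f (Suc i) * b ^ i)"
    by (subst sum.lessThan_Suc_shift) (simp add: sum_distrib_left ac_simps)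
  then have "digit_power_sum e b (\<Sum>i<Suc n. f i * b ^ i)
      = f 0 ^ e + digit_power_sum e b (\<Sum>i<n. f (Suc i) * b ^ i)"
    using digit_power_sum_rec[OF assms(1,2), of "f 0 + b * (\<Sum>i<n. f (Suc i) * b ^ i)"]
      Suc.prems[of 0] by simp
  also have "digit_power_sum e b (\<Sum>i<n. f (Suc i) * b ^ i) = (\<Sum>i<n. f (Suc i) ^ e)"
    using Suc.prems by (intro Suc.IH) simp
  finally show ?case
    by (simp add: sum.lessThan_Suc_shift del: sum.lessThan_Suc)
qed simp

lemma digit_power_sum_pos:
  assumes "b \<ge> 2" and "e \<ge> 1" and "x > 0"
  shows "digit_power_sum e b x > 0"
  using assms(3)
proof (induction x rule: less_induct)
  case (less x)
  show ?case
  proof (cases "x < b")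
    case True
    then show ?thesis
      using less.prems by (subst digit_power_sum_rec[OF assms(1,2)]) simp
  next
    case False
    then have "0 < x div b" and "x div b < x"
      using assms(1) less.prems by (auto simp: div_greater_zero_iff)
    then show ?thesis
      using less.IH[of "x div b"] by (subst digit_power_sum_rec[OF assms(1,2)]) simp
  qed
qed

lemma digit_power_sum_le:
  assumes "b \<ge> 2" and "e \<ge> 1" and "x < b ^ n"
  shows "digit_power_sum e b x \<le> n * (b - 1) ^ e"
proof -
  have "digit b x i ^ e \<le> (b - 1) ^ e" for i
    using digit_less[of b x i] assms(1) by (intro power_mono) auto
  then show ?thesis
    using sum_bounded_above[of "{..<n}" "\<lambda>i. digit b x i ^ e" "(b - 1) ^ e"]
    by (simp add: digit_power_sum_eq_sum[OF assms])
qed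

lemma digit_sum_le:
  assumes "b \<ge> 2"
  shows "digit_power_sum 1 b x \<le> x"
proof (induction x rule: less_induct)
  case (less x)
  show ?case
  proof (cases "x = 0")
    case False
    then have "digit_power_sum 1 b (x div b) \<le> x div b"
      using assms by (intro less.IH) simp
    also have "\<dots> \<le> b * (x div b)"
      using assms by simp
    finally have "(x mod b) ^ 1 + digit_power_sum 1 b (x div b) \<le> x mod b + b * (x div b)"
      by (simp only: power_one_right add_le_cancel_left)
    then have "digit_power_sum 1 b x \<le> x mod b + b * (x div b)"
      by (simp only: digit_power_sum_rec[OF assms order_refl, of x])
    then show ?thesis by (simp only: mod_mult_div_eq)
  qed simp
qed

lemma digit_sum_less:
  assumes "b \<ge> 2" and "x \<ge> b"
  shows "digit_power_sum 1 b x < x"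
proof -
  have "0 < x div b"
    using assms by (simp add: div_greater_zero_iff)
  then have "x div b < b * (x div b)"
    using assms by simp
  then have "x mod b + digit_power_sum 1 b (x div b) < x mod b + b * (x div b)"
    using digit_sum_le[OF assms(1), of "x div b"] by linarith
  then show ?thesis
    using digit_power_sum_rec[OF assms(1) order_refl, of x]
    by (simp only: mod_mult_div_eq power_one_right)
qed

section \<open>Numbers with many digits are not periodic\<close>

text \<open>Raising \<open>e\<close> by one multiplies the left side by \<open>2 * (b - 1)\<close>
  and the right side by \<open>b ^ 2 ^ e\<close>, which is at least \<open>b * b\<close>. For
  \<open>e = 1\<close> the inequality fails.\<close>

lemma power_bound_base:
  fixes b e :: nat
  assumes "b \<ge> 2" and "e \<ge> 2"
  shows "2 ^ e * (b - 1) ^ e < b ^ (2 ^ e - 1)"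
  using assms(2)
proof (induction e rule: dec_induct)
  case base
  obtain c where b: "b = c + 2"
    using assms(1) by (metis add.commute le_Suc_ex)
  have "4 * (c + 1) ^ 2 < (c + 2) ^ 3"
    by (simp add: power2_eq_square power3_eq_cube algebra_simps)
  moreover have "(2::nat) ^ 2 = 4" "(4::nat) - 1 = 3" "b - 1 = c + 1"
    by (simp_all add: b)
  ultimately show ?case
    by (simp only: b)
next
  case (step e)
  have "2 * (b - 1) \<le> b * b"
    using assms(1) by (intro mult_mono) auto
  also have "\<dots> \<le> b ^ 2 ^ e"
    using power_increasing[of 2 "2 ^ e" b] step.hyps assms(1) self_le_power[of 2 e]
    by (simp add: power2_eq_square)
  finally have 2: "2 * (b - 1) \<le> b ^ 2 ^ e" .
  have "2 ^ Suc e * (b - 1) ^ Suc e = (2 ^ e * (b - 1) ^ e) * (2 * (b - 1))"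
    by simp
  also have "\<dots> < b ^ (2 ^ e - 1) * (2 * (b - 1))"
    using step.IH assms(1) by (intro mult_strict_right_mono) auto
  also have "\<dots> \<le> b ^ (2 ^ e - 1) * b ^ 2 ^ e"
    using 2 by (rule mult_left_mono) simp
  also have "\<dots> = b ^ (2 ^ Suc e - 1)"
    by (simp add: power_add[symmetric] mult_2)
  finally show ?case .
qed

text \<open>One more digit multiplies the right side by \<open>b\<close> and the left side by at
  most 2.\<close>

lemma power_bound:
  fixes b e D :: nat
  assumes "b \<ge> 2" and "e \<ge> 2" and "D \<ge> 2 ^ e"
  shows "D * (b - 1) ^ e < b ^ (D - 1)"
  using assms(3)
proof (induction D rule: dec_induct)
  case base
  then show ?case using power_bound_base[OF assms(1,2)] by simp
next
  case (step D)
  have "D > 0"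
    using step.hyps(1) by (metis gr0I le_zero_eq power_not_zero zero_neq_numeral)
  then have "Suc D * (b - 1) ^ e \<le> b * D * (b - 1) ^ e"
    using assms(1) mult_le_mono1[of 2 b D] by (intro mult_right_mono) linarith+
  also have "\<dots> < b * b ^ (D - 1)"
    using step.IH assms(1) by (simp add: mult.assoc)
  also have "\<dots> = b ^ (Suc D - 1)"
    using \<open>D > 0\<close> by (simp add: power_eq_if)
  finally show ?case .
qed

text \<open>Allowing every \<open>z \<le> u\<close> lets the bound be applied again to each iterate
  of \<open>u\<close>, which then never climbs back to \<open>u\<close>.\<close>

lemma digit_power_sum_less_of_le:
  assumes "b \<ge> 2" and "e \<ge> 1" and "floorlog b u \<ge> 2 ^ e" and "z \<le> u"
  shows "digit_power_sum e b z < u"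
proof -
  have u: "u > 0"
    using assms(3) by (cases "u = 0") (auto simp: floorlog_def)
  note bounds = floorlog_bounds_nat[OF assms(1) u]
  show ?thesis
  proof (cases "e = 1")
    case True
    \<comment> \<open>\<open>power_bound\<close> does not cover \<open>e = 1\<close>; here two
      digits suffice, since a digit sum is smaller than a number that is at least
      \<open>b\<close>.\<close>
    have "b ^ 1 \<le> b ^ (floorlog b u - 1)"
      using assms(1,3) True by (intro power_increasing) auto
    then have "b \<le> u"
      using bounds(1) by simp
    then show ?thesis
      using digit_sum_less[OF assms(1), of u] digit_sum_le[OF assms(1), of z] assms(4) True
      by (cases "z = u") auto
  next
    case False
    have "digit_power_sum e b z \<le> floorlog b u * (b - 1) ^ e"
      using bounds(2) assms by (intro digit_power_sum_le) auto
    also have "\<dots> < b ^ (floorlog b u - 1)"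
      using assms False by (intro power_bound) auto
    also have "\<dots> \<le> u"
      by (rule bounds(1))
    finally show ?thesis .
  qed
qed

lemma not_periodic:
  assumes "b \<ge> 2" and "e \<ge> 1" and "floorlog b u \<ge> 2 ^ e" and "h \<ge> 1"
  shows "(digit_power_sum e b ^^ h) u \<noteq> u"
proof -
  have "(digit_power_sum e b ^^ Suc k) u < u" for k
  proof (induction k)
    case 0
    then show ?case
      using digit_power_sum_less_of_le[OF assms(1-3), of u] by simp
  next
    case (Suc k)
    then show ?case
      using digit_power_sum_less_of_le[OF assms(1-3), of "(digit_power_sum e b ^^ Suc k) u"] by simp
  qed
  from this[of "h - 1"] show ?thesis
    using assms(4) by simp
qed

section \<open>Existence of attracted numbers\<close>

text \<open>The trajectory of \<open>x\<close> is \<open>x\<close> followed by that of its digit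
  power sum, so \<open>x \<noteq> u\<close> is all that could spoil the height.\<close>

lemma attracted_SucI:
  assumes "attracted h e b u (digit_power_sum e b x)" and "x > 0" and "x \<noteq> u"
  shows "attracted (Suc h) e b u x"
  using assms unfolding attracted_def
  by (auto simp: less_Suc_eq_0_disj funpow_swap1 funpow_Suc_right simp del: funpow.simps(2))

lemma attracted_SucD:
  assumes "attracted (Suc h) e b u x" and "b \<ge> 2" and "e \<ge> 1"
  shows "attracted h e b u (digit_power_sum e b x)"
  using assms digit_power_sum_pos[OF assms(2,3), of x] unfolding attracted_def
  by (auto simp: less_Suc_eq_0_disj funpow_Suc_right simp del: funpow.simps(2))

lemma ex_preimage:
  assumes "b \<ge> 2" and "e \<ge> 1" and "y > 0"
  shows "\<exists>x>0. x \<noteq> u \<and> digit_power_sum e b x = y"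
proof -
  \<comment> \<open>The repunit with \<open>y\<close> ones. Should it equal \<open>u\<close>,
    appending a zero gives a different preimage.\<close>
  let ?r = "\<Sum>i<y. 1 * b ^ i"
  have r: "digit_power_sum e b ?r = y"
    using digit_power_sum_positional[OF assms(1,2), of y "\<lambda>_. 1"] assms(1) by simp
  have pos: "?r > 0"
  proof (rule gr0I)
    assume "?r = 0"
    then show False using r assms(3) by (metis digit_power_sum_0 less_not_refl)
  qed
  show ?thesis
  proof (cases "?r = u")
    case False
    then show ?thesis using r pos by blast
  next
    case True
    have "b * ?r > 0" and "b * ?r \<noteq> u"
      using pos True assms(1) by auto
    then show ?thesis
      using digit_power_sum_mult_base[OF assms(1,2), of ?r] r by metis
  qed
qed

lemma ex_attracted:
  assumes "b \<ge> 2" and "e \<ge> 1" and "u > 0"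
  shows "\<exists>x. attracted h e b u x"
proof (induction h)
  case 0
  then show ?case
    using assms(3) by (auto simp: attracted_def)
next
  case (Suc h)
  then obtain y where y: "attracted h e b u y" ..
  then have "y > 0"
    by (simp add: attracted_def)
  then obtain x where "x > 0" "x \<noteq> u" "digit_power_sum e b x = y"
    using ex_preimage[OF assms(1,2)] by blast
  then show ?case
    using attracted_SucI y by blast
qed

section \<open>Least preimages of digit power sums\<close>

text \<open>The number \<open>2 ^ e - 1\<close> is a sum of zeros and ones only, so it needs
  \<open>2 ^ e - 1\<close> ones. This links the length hypothesis to the threshold of
  \<open>not_periodic\<close>.\<close>

lemma waring_lower_bound:
  assumes "all_sums_of_powers e s"
  shows "2 ^ e \<le> s + 1"
proof -
  obtain x :: "nat \<Rightarrow> nat" where x: "2 ^ e - 1 = (\<Sum>i<s. x i ^ e)"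
    using assms unfolding all_sums_of_powers_def by blast
  have "x i ^ e \<le> 1" if "i < s" for i
  proof -
    have "x i ^ e \<le> (\<Sum>i<s. x i ^ e)"
      using that by (intro member_le_sum) auto
    also have "\<dots> < 2 ^ e"
      unfolding x[symmetric] by simp
    finally have "x i < 2"
      by (meson leI power_mono zero_le leD)
    then have "x i ^ e \<le> 1 ^ e"
      by (intro power_mono) auto
    then show ?thesis by simp
  qed
  then have "(\<Sum>i<s. x i ^ e) \<le> s"
    using sum_bounded_above[of "{..<s}" "\<lambda>i. x i ^ e" 1] by simp
  then show ?thesis
    using x by linarith
qed

lemma fewer_digits:
  fixes f :: "nat \<Rightarrow> nat"
  assumes "all_sums_of_powers e s" and "b \<ge> 2" and "e \<ge> 1"
    and f: "\<And>i. i < m \<Longrightarrow> f i \<le> b - 2"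
    and m: "real m * (1 - ((real b - 2) / (real b - 1)) ^ e) \<ge> real s + 1"
  shows "\<exists>f' m'. m' < m \<and> (\<forall>i<m'. f' i < b) \<and> (\<Sum>i<m'. f' i ^ e) = (\<Sum>i<m. f i ^ e)"
proof -
  define c where "c = b - 1"
  define T where "T = (\<Sum>i<m. f i ^ e)"
  define q where "q = T div c ^ e"
  have c: "c > 0" "real c = real b - 1" "c < b"
    using assms(2) by (auto simp: c_def)
  have "T \<le> m * (b - 2) ^ e"
    using sum_bounded_above[of "{..<m}" "\<lambda>i. f i ^ e" "(b - 2) ^ e"] f
    by (simp add: T_def power_mono)
  moreover have "q * c ^ e \<le> T"
    by (simp add: q_def)
  ultimately have "q * c ^ e \<le> m * (b - 2) ^ e"
    by (rule order_trans[rotated])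
  then have "real (q * c ^ e) \<le> real (m * (b - 2) ^ e)"
    by (rule of_nat_mono)
  then have "real q * real c ^ e \<le> real m * (real b - 2) ^ e"
    using assms(2) by (simp add: of_nat_diff)
  \<comment> \<open>At least \<open>s + 1\<close> of the \<open>m\<close> digits are thus saved:
    \<open>s\<close> of them hold the remainder and one is gained.\<close>
  then have "real q \<le> real m * ((real b - 2) / (real b - 1)) ^ e"
    using c by (simp add: power_divide field_simps)
  then have "real q + real s + 1 \<le> real m"
    using m by (simp add: algebra_simps)
  then have lt: "q + s < m"
    by linarith
  obtain z :: "nat \<Rightarrow> nat" where z: "T mod c ^ e = (\<Sum>i<s. z i ^ e)"
    using assms(1) unfolding all_sums_of_powers_def by blast
  \<comment> \<open>The remainder is below \<open>c ^ e\<close>, so the bases of its powers are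
    admissible digits.\<close>
  have zb: "z i < b" if "i < s" for i
  proof -
    have "z i ^ e \<le> (\<Sum>i<s. z i ^ e)"
      using that by (intro member_le_sum) auto
    also have "\<dots> < c ^ e"
      unfolding z[symmetric] using c(1) by simp
    finally have "z i < c"
      by (meson leI power_mono zero_le leD)
    then show ?thesis
      using c(3) by simp
  qed
  define f' where "f' i = (if i < q then c else z (i - q))" for i
  have "(\<Sum>i<q + s. f' i ^ e) = q * c ^ e + T mod c ^ e"
    unfolding sum_lessThan_add z by (simp add: f'_def)
  also have "\<dots> = T"
    unfolding q_def by (rule div_mult_mod_eq)
  finally have "(\<Sum>i<q + s. f' i ^ e) = T" .
  moreover have "\<forall>i<q + s. f' i < b"
    using zb c(3) by (auto simp: f'_def)
  ultimately show ?thesis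
    using lt unfolding T_def by blast
qed

text \<open>Swapping a larger digit at \<open>i\<close> with a smaller one at \<open>j\<close> keeps
  the digit power sum and lowers the value by their difference times
  \<open>b ^ i - b ^ j\<close>.\<close>

lemma least_preimage_digit_mono:
  assumes "b \<ge> 2" and "e \<ge> 1" and "x > 0"
    and least: "\<And>k. 0 < k \<Longrightarrow> digit_power_sum e b k = digit_power_sum e b x \<Longrightarrow> x \<le> k"
    and "j < i" and "i < floorlog b x"
  shows "digit b x i \<le> digit b x j"
proof (rule ccontr)
  assume "\<not> ?thesis"
  then have lt: "digit b x j < digit b x i" by simp
  define n where "n = floorlog b x"
  define f where "f = digit b x"
  define f' where "f' = f(i := f j, j := f i)"
  have xn: "x < b ^ n"
    unfolding n_def using floorlog_bounds_nat(2)[OF assms(1,3)] .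
  have ij: "i \<in> {..<n}" "j \<in> {..<n} - {i}" "i \<noteq> j"
    using assms(5,6) by (auto simp: n_def)
  have split: "sum F {..<n} = F i + (F j + sum F ({..<n} - {i} - {j}))" for F :: "nat \<Rightarrow> nat"
    using ij by (simp add: sum.remove[of _ i F] sum.remove[of _ j F])
  have rest: "sum (\<lambda>k. G (f' k) k) ({..<n} - {i} - {j}) = sum (\<lambda>k. G (f k) k) ({..<n} - {i} - {j})"
    for G :: "nat \<Rightarrow> nat \<Rightarrow> nat"
    by (intro sum.cong) (auto simp: f'_def)
  have f'b: "f' k < b" for k
    using digit_less[of b x] assms(1) by (auto simp: f'_def f_def)
  let ?V = "\<Sum>k<n. f' k * b ^ k"
  have "digit_power_sum e b ?V = (\<Sum>k<n. f' k ^ e)"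
    using f'b by (intro digit_power_sum_positional assms) auto
  also have "\<dots> = (\<Sum>k<n. f k ^ e)"
    unfolding split using rest[of "\<lambda>a _. a ^ e"] ij by (simp add: f'_def)
  also have "\<dots> = digit_power_sum e b x"
    using digit_power_sum_eq_sum[OF assms(1,2) xn] by (simp add: f_def)
  finally have V: "digit_power_sum e b ?V = digit_power_sum e b x" .
  have "?V > 0"
  proof (rule gr0I)
    assume "?V = 0"
    then show False
      using V digit_power_sum_pos[OF assms(1-3)] by (metis digit_power_sum_0 less_not_refl)
  qed
  then have "x \<le> ?V"
    using V by (rule least)
  also have "?V < (\<Sum>k<n. f k * b ^ k)"
  proof -
    have "b ^ j < b ^ i"
      using assms(1,5) by (intro power_strict_increasing) auto
    moreover obtain t where "f i = f j + t" "t > 0"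
      using lt unfolding f_def by (metis less_imp_add_positive)
    ultimately have "f j * b ^ i + f i * b ^ j < f i * b ^ i + f j * b ^ j"
      by (simp add: algebra_simps)
    then show ?thesis
      unfolding split using rest[of "\<lambda>a k. a * b ^ k"] ij by (simp add: f'_def)
  qed
  also have "\<dots> = x"
    unfolding f_def using xn by (rule sum_digits_eq)
  finally show False by simp
qed

lemma least_preimage_digit:
  assumes "b \<ge> 2" and "e \<ge> 1" and "x > 0" and "all_sums_of_powers e s"
    and least: "\<And>k. 0 < k \<Longrightarrow> digit_power_sum e b k = digit_power_sum e b x \<Longrightarrow> x \<le> k"
    and "j < floorlog b x"
    and len: "real (floorlog b x - j) * (1 - ((real b - 2) / (real b - 1)) ^ e) \<ge> real s + 1"
  shows "digit b x j = b - 1"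
proof (rule ccontr)
  assume neq: "digit b x j \<noteq> b - 1"
  define n where "n = floorlog b x"
  define m where "m = n - j"
  have n: "n = j + m"
    using assms(6) by (simp add: m_def n_def)
  note xn = floorlog_bounds_nat[OF assms(1,3), folded n_def]
  have j2: "digit b x j \<le> b - 2"
    using neq digit_less[of b x j] assms(1) by linarith
  have top: "digit b x (j + i) \<le> b - 2" if "i < m" for i
  proof (cases "i = 0")
    case False
    then have "digit b x (j + i) \<le> digit b x j"
      using that n by (intro least_preimage_digit_mono[OF assms(1-3) least]) (auto simp: n_def)
    then show ?thesis
      using j2 by simp
  qed (use j2 in simp)
  obtain f' m' where f': "m' < m" "\<forall>i<m'. f' i < b"
    and sum: "(\<Sum>i<m'. f' i ^ e) = (\<Sum>i<m. digit b x (j + i) ^ e)"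
    using fewer_digits[of e s b m "\<lambda>i. digit b x (j + i)", OF assms(4,1,2) top]
      len[folded n_def, folded m_def] by blast
  \<comment> \<open>The digits below \<open>j\<close> stay and a shorter block replaces the rest.
    Whatever its digits are, the value falls below \<open>b ^ (n - 1)\<close>.\<close>
  define f where "f i = (if i < j then digit b x i else f' (i - j))" for i
  have fb: "f i < b" if "i < j + m'" for i
    using that f'(2) digit_less[of b x i] assms(1) by (auto simp: f_def)
  let ?V = "\<Sum>i<j + m'. f i * b ^ i"
  have "digit_power_sum e b ?V = (\<Sum>i<j + m'. f i ^ e)"
    using fb by (intro digit_power_sum_positional assms) auto
  also have "\<dots> = (\<Sum>i<n. digit b x i ^ e)"
    unfolding n sum_lessThan_add sum[symmetric] by (simp add: f_def)
  also have "\<dots> = digit_power_sum e b x"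
    using digit_power_sum_eq_sum[OF assms(1,2) xn(2)] by simp
  finally have V: "digit_power_sum e b ?V = digit_power_sum e b x" .
  have "?V > 0"
  proof (rule gr0I)
    assume "?V = 0"
    then show False
      using V digit_power_sum_pos[OF assms(1-3)] by (metis digit_power_sum_0 less_not_refl)
  qed
  then have "x \<le> ?V"
    using V by (rule least)
  also have "?V < b ^ (j + m')"
    using fb by (rule positional_less)
  also have "\<dots> \<le> b ^ (n - 1)"
    using f'(1) n assms(1) by (intro power_increasing) auto
  also have "\<dots> \<le> x"
    by (rule xn(1))
  finally show False by simp
qed

text \<open>Frees the later argument from heights: a competitor only needs the same digit power sum.
  The \<open>+ 1\<close> in \<open>long\<close> pays for the digit lost between \<open>b * u\<close>
  and \<open>u\<close>.\<close>

lemma sigma_least_preimage: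
  fixes b e h u k :: nat
  defines "x \<equiv> sigma h e b u"
  assumes "b \<ge> 2" and "e \<ge> 1" and "h \<ge> 1" and "u \<ge> 1"
    and long: "2 ^ e + 1 \<le> floorlog b x"
    and "k > 0" and eq: "digit_power_sum e b k = digit_power_sum e b x"
  shows "x \<le> k"
proof -
  obtain h' where h: "h = Suc h'"
    using assms(4) by (cases h) auto
  have x: "attracted h e b u x"
    unfolding x_def sigma_def by (rule LeastI_ex, rule ex_attracted) (use assms in auto)
  then have y: "attracted h' e b u (digit_power_sum e b x)"
    using attracted_SucD assms(2,3) by (simp add: h)
  have least: "x \<le> l" if "l > 0" "l \<noteq> u" "digit_power_sum e b l = digit_power_sum e b x" for l
    unfolding x_def sigma_def using that y attracted_SucI[of h' e b u l]
    by (intro Least_le) (simp add: h)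
  have "k \<noteq> u"
  proof
    assume k: "k = u"
    \<comment> \<open>\<open>b * u\<close> is a preimage other than \<open>u\<close>, so
      \<open>least\<close> applies to it.\<close>
    have "x \<le> b * u"
      using k assms(2,5) eq
      by (intro least) (simp_all add: digit_power_sum_mult_base[OF assms(2,3)])
    then have "floorlog b x \<le> floorlog b (u * b ^ 1)"
      using assms(2) by (intro floorlog_mono) (simp add: mult.commute)
    also have "\<dots> = floorlog b u + 1"
      using assms(2,5) floorlog_power[of u b 1] by simp
    finally have "2 ^ e \<le> floorlog b u"
      using long by simp
    then have "(digit_power_sum e b ^^ h) u \<noteq> u"
      using assms by (intro not_periodic) auto
    \<comment> \<open>One step takes \<open>u\<close> to the digit power sum of \<open>x\<close>,
      and \<open>h'\<close> further steps lead back to \<open>u\<close>.\<close>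
    moreover have "(digit_power_sum e b ^^ h) u = u"
      using y eq k by (simp add: h attracted_def funpow_Suc_right del: funpow.simps(2))
    ultimately show False by simp
  qed
  then show ?thesis
    using least assms(7) eq by blast
qed

theorem theorem3p1:
  fixes b e h u \<delta> n :: nat and d :: ereal
  assumes "b \<ge> 2" and "e \<ge> 1" and "h \<ge> 1" and "u \<ge> 1" and "\<delta> \<ge> 1"
    and "d = (ereal_of_enat (waring_g e) + 1)
               / ereal (1 - ((real b - 2) / (real b - 1)) ^ e) + ereal (real \<delta>)"
    and "n = floorlog b (sigma h e b u)"
    and "ereal (real n) \<ge> d"
  shows "sigma h e b u = (\<Sum>i<n. digit b (sigma h e b u) i * b ^ i)
         \<and> \<delta> < n \<and> (\<forall>i\<le>\<delta>. digit b (sigma h e b u) i = b - 1)"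
proof -
  define x where "x = sigma h e b u"
  define r where "r = 1 - ((real b - 2) / (real b - 1)) ^ e"
  have "0 \<le> (real b - 2) / (real b - 1)" "(real b - 2) / (real b - 1) < 1"
    using assms(1) by auto
  then have r: "0 < r" "r \<le> 1"
    using assms(2) by (auto simp: r_def power_less_one_iff)
  \<comment> \<open>An infinite \<open>waring_g e\<close> would make \<open>d\<close> infinite, out
    of reach of the finite \<open>n\<close>.\<close>
  obtain s where s: "waring_g e = enat s"
  proof (cases "waring_g e")
    case infinity
    then have "d = \<infinity>"
      using assms(6) r by (simp add: r_def[symmetric])
    then show ?thesis
      using assms(8) by simp
  qed
  then have W: "all_sums_of_powers e s"
    by (simp add: waring_g_eq_iff)
  have "d = ereal ((real s + 1) / r + real \<delta>)"
    using assms(6) r by (simp add: s r_def[symmetric] one_ereal_def)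
  then have d: "(real s + 1) / r + real \<delta> \<le> real n"
    using assms(8) by simp
  \<comment> \<open>Since \<open>r \<le> 1\<close>, division by \<open>r\<close> only enlarges
    \<open>s + 1\<close>, which yields an integer lower bound for \<open>n\<close>.\<close>
  have "(real s + 1) * r \<le> real s + 1"
    using r by (intro mult_left_le) auto
  then have "real s + 1 \<le> (real s + 1) / r"
    using r by (simp add: pos_le_divide_eq)
  then have n: "s + 1 + \<delta> \<le> n"
    using d by linarith
  \<comment> \<open>Here \<open>\<delta> \<ge> 1\<close> supplies the digit beyond
    \<open>2 ^ e\<close>.\<close>
  then have "2 ^ e + 1 \<le> floorlog b x"
    using waring_lower_bound[OF W] assms(5,7) by (simp add: x_def)
  note least = sigma_least_preimage[OF assms(1-4) this[unfolded x_def], folded x_def]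
  have "x > 0"
    using n assms(7) by (intro gr0I) (simp add: x_def floorlog_def)
  have "digit b x i = b - 1" if "i \<le> \<delta>" for i
  proof (rule least_preimage_digit[OF assms(1,2) \<open>x > 0\<close> W least])
    show "i < floorlog b x"
      using that n assms(7) by (simp add: x_def)
    \<comment> \<open>The summand \<open>\<delta>\<close> of \<open>d\<close> covers the
      \<open>i \<le> \<delta>\<close> positions below \<open>i\<close>.\<close>
    have "(real s + 1) / r \<le> real (n - i)"
      using d that n by (simp add: of_nat_diff)
    then show "real s + 1 \<le> real (floorlog b x - i) * (1 - ((real b - 2) / (real b - 1)) ^ e)"
      using r assms(7) by (simp add: x_def r_def[symmetric] pos_divide_le_eq del: of_nat_diff)
  qed
  moreover have "(\<Sum>i<n. digit b x i * b ^ i) = x"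
    using floorlog_bounds_nat(2)[OF assms(1) \<open>x > 0\<close>] assms(7)
    by (intro sum_digits_eq) (simp add: x_def)
  moreover have "\<delta> < n"
    using n by simp
  ultimately show ?thesis
    by (simp add: x_def)
qed

end
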